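(* Let $\mu$ be a Borel probability measure on $\mathbb{R}$ with all moments finite and with infinitely many points of increase, and let $P=\{p_n\}_{n\in\mathbb{Z}_+}$ be a system of orthonormal polynomials with respect to $\mathrm{d}\mu$ (real polynomials, $\deg p_n=n$). Let $g\in \mathrm{L}_2(\mathbb{R})$, not almost everywhere zero, be a (complex-valued) function such that $|\xi^n g(\xi)|\to 0$ as $|\xi|\to\infty$ for every integer $n\ge 0$, and let $\{\theta_n\}_{n\in\mathbb{Z}_+}\subset[0,2\pi)$. Define $\Phi=\{\varphi_n\}_{n\in\mathbb{Z}_+}\subset \mathrm{L}_2(\mathbb{R})$ by $$\varphi_n(x)=\frac{\mathrm{e}^{\mathrm{i}\theta_n}}{\sqrt{2\pi}}\int_{-\infty}^{\infty}\mathrm{e}^{\mathrm{i}x\xi}\,p_n(\xi)\,g(\xi)\,\mathrm{d}\xi,\qquad x\in\mathbb{R},\ n\in\mathbb{Z}_+.$$ Then $\Phi$ is orthogonal in $\mathrm{L}_2(\mathbb{R})$ if and only if $P$ is orthogonal with respect to the measure $|g(\xi)|^2\,\mathrm{d}\xi$. Furthermore, whenever $\Phi$ is orthogonal, the functions $\varphi_n/\|g\|_2$, $n\in\mathbb{Z}_+$, are orthonormal in $\mathrm{L}_2(\mathbb{R})$.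
   Context: $\mathbb{Z}_+=\{0,1,2,\ldots\}$. $\mathrm{L}_2(\mathbb{R})$ is the space of complex-valued square-integrable functions with the inner product $\int_{-\infty}^\infty \overline{f(x)}\,h(x)\,\mathrm{d}x$, and $\|g\|_2=\left(\int_{-\infty}^\infty|g(\xi)|^2\,\mathrm{d}\xi\right)^{1/2}$. "Infinitely many points of increase" means that the support of $\mu$ is an infinite set. Orthonormality of $P$ with respect to $\mathrm{d}\mu$ means $\int p_m p_n\,\mathrm{d}\mu=\delta_{m,n}$ for all $m,n$. "Orthogonal" (for $\Phi$, or for $P$ with respect to $|g(\xi)|^2\mathrm{d}\xi$) means that the inner product of any two members with distinct indices vanishes, i.e. $\int_{-\infty}^\infty\overline{\varphi_n}\varphi_m\,\mathrm{d}x=0$, respectively $\int_{-\infty}^\infty p_m(\xi)p_n(\xi)|g(\xi)|^2\,\mathrm{d}\xi=0$, for all $m\neq n$. *)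

theory Defs
  imports "HOL-Probability.Probability"
begin

text \<open>Elements of \<open>L2_space\<close> are functions rather than classes modulo null sets, because the
  decay condition on \<open>g\<close> is pointwise.\<close>

definition L2_space :: "(real \<Rightarrow> complex) set" where
  "L2_space = {f \<in> borel_measurable lebesgue. integrable lebesgue (\<lambda>x. (cmod (f x))\<^sup>2)}"

definition L2_inner :: "(real \<Rightarrow> complex) \<Rightarrow> (real \<Rightarrow> complex) \<Rightarrow> complex" where
  "L2_inner f h = (LINT x|lebesgue. cnj (f x) * h x)"

definition L2_nrm :: "(real \<Rightarrow> complex) \<Rightarrow> real" where
  "L2_nrm f = sqrt (LINT x|lebesgue. (cmod (f x))\<^sup>2)"

definition orthogonal_family :: "(nat \<Rightarrow> real \<Rightarrow> complex) \<Rightarrow> bool" where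
  "orthogonal_family \<phi> \<longleftrightarrow> (\<forall>m n. m \<noteq> n \<longrightarrow> L2_inner (\<phi> m) (\<phi> n) = 0)"

definition orthonormal_family :: "(nat \<Rightarrow> real \<Rightarrow> complex) \<Rightarrow> bool" where
  "orthonormal_family \<phi> \<longleftrightarrow> (\<forall>m n. L2_inner (\<phi> m) (\<phi> n) = (if m = n then 1 else 0))"

definition measure_support :: "real measure \<Rightarrow> real set" where
  "measure_support M = {x. \<forall>U. open U \<and> x \<in> U \<longrightarrow> emeasure M U > 0}"

definition orthogonal_polys :: "real measure \<Rightarrow> (nat \<Rightarrow> real poly) \<Rightarrow> bool" where
  "orthogonal_polys M p \<longleftrightarrow>
     (\<forall>m n. m \<noteq> n \<longrightarrow> (LINT x|M. poly (p m) x * poly (p n) x) = 0)"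

definition orthonormal_polys :: "real measure \<Rightarrow> (nat \<Rightarrow> real poly) \<Rightarrow> bool" where
  "orthonormal_polys M p \<longleftrightarrow>
     (\<forall>m n. (LINT x|M. poly (p m) x * poly (p n) x) = (if m = n then 1 else 0))"

definition fourier_family ::
  "(nat \<Rightarrow> real poly) \<Rightarrow> (real \<Rightarrow> complex) \<Rightarrow> (nat \<Rightarrow> real) \<Rightarrow> nat \<Rightarrow> real \<Rightarrow> complex" where
  "fourier_family p g \<theta> n x =
     exp (\<i> * complex_of_real (\<theta> n)) / complex_of_real (sqrt (2 * pi)) *
     (LINT \<xi>|lebesgue. exp (\<i> * complex_of_real (x * \<xi>)) * complex_of_real (poly (p n) \<xi>) * g \<xi>)"

end

theory Submission
  imports Defs
begin

text \<open>
  The cross-correlation \<open>A(t) = \<integral> cnj (f x) h(x + t) dx\<close> of \<open>f, h \<in> L\<^sub>1 \<inter> L\<^sub>2\<close> is integrable, bounded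
  and, since translation is continuous in \<open>L\<^sub>2\<close>, continuous at \<open>0\<close>; its Fourier transform is
  \<open>cnj (F f) F h\<close>. Gaussian summation inverts this transform at the origin, where \<open>A(0) = \<langle>f, h\<rangle>\<close>:
  for \<open>h = f\<close> monotone convergence gives \<open>F f \<in> L\<^sub>2\<close>, and dominated convergence then yields
  Parseval's identity.

  As each \<open>p\<^sub>n g\<close> lies in \<open>L\<^sub>1 \<inter> L\<^sub>2\<close>, the inner products of the \<open>\<phi>\<^sub>n\<close> are the integrals of
  \<open>p\<^sub>m p\<^sub>n |g|\<^sup>2\<close> up to unimodular factors; this is the equivalence. If the \<open>p\<^sub>n\<close> are orthogonal for
  both \<open>\<mu>\<close> and \<open>|g|\<^sup>2 d\<xi>\<close>, then both measures annihilate \<open>p\<^sub>n\<close> for \<open>n \<ge> 1\<close>. As the \<open>p\<^sub>n\<close> span all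
  polynomials, the two integrals are proportional on polynomials, with factor \<open>\<parallel>g\<parallel>\<^sup>2\<close>, which gives
  the norms of the \<open>\<phi>\<^sub>n\<close>.
\<close>

section \<open>Continuity of translation in the mean\<close>

lemma integrable_translate:
  fixes f :: "'n::euclidean_space \<Rightarrow> 'a::{banach, second_countable_topology}"
  assumes "integrable lborel f"
  shows "integrable lborel (\<lambda>x. f (x + t))"
proof -
  have "integrable (distr lborel borel ((+) t)) f"
    using assms by (simp add: lborel_distr_plus)
  then show ?thesis
    by (subst (asm) integrable_distr_eq) (use assms in \<open>auto simp: add.commute\<close>)
qed

lemma integral_translate:
  fixes f :: "'n::euclidean_space \<Rightarrow> 'a::{banach, second_countable_topology}"
  assumes "f \<in> borel_measurable borel"
  shows "(LINT x|lborel. f (x + t)) = (LINT x|lborel. f x)"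
proof -
  have "(LINT x|lborel. f x) = (LINT x|distr lborel borel ((+) t). f x)"
    by (simp add: lborel_distr_plus)
  also have "\<dots> = (LINT x|lborel. f (x + t))"
    using assms by (subst integral_distr) (auto simp: add.commute)
  finally show ?thesis ..
qed

definition L1_modulus ::
  "('n::euclidean_space \<Rightarrow> 'a::{banach, second_countable_topology}) \<Rightarrow> 'n \<Rightarrow> real" where
  "L1_modulus f t = (LINT x|lborel. norm (f (x + t) - f x))"

lemma L1_modulus_nonneg: "0 \<le> L1_modulus f t"
  by (simp add: L1_modulus_def)

lemma L1_modulus_add_le:
  assumes "integrable lborel f" "integrable lborel g"
  shows "L1_modulus (\<lambda>x. f x + g x) t \<le> L1_modulus f t + L1_modulus g t"
proof -
  note integrable = assms assms[THEN integrable_translate, of t]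
  have "L1_modulus (\<lambda>x. f x + g x) t
      \<le> (LINT x|lborel. norm (f (x + t) - f x) + norm (g (x + t) - g x))"
    unfolding L1_modulus_def using integrable
    by (intro integral_mono norm_diff_triangle_ineq) auto
  also have "\<dots> = L1_modulus f t + L1_modulus g t"
    unfolding L1_modulus_def using integrable by simp
  finally show ?thesis .
qed

lemma L1_modulus_le_twice_L1_norm:
  assumes "integrable lborel f"
  shows "L1_modulus f t \<le> 2 * (LINT x|lborel. norm (f x))"
proof -
  note integrable = assms integrable_translate[OF assms, of t]
  have "L1_modulus f t \<le> (LINT x|lborel. norm (f (x + t)) + norm (f x))"
    unfolding L1_modulus_def using integrable
    by (intro integral_mono norm_triangle_ineq4) auto
  also have "\<dots> = 2 * (LINT x|lborel. norm (f x))"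
    using integrable integral_translate[of "\<lambda>x. norm (f x)" t] by simp
  finally show ?thesis .
qed

lemma L1_modulus_tendsto_0_limit:
  assumes s: "\<And>i::nat. integrable lborel (s i)" "\<And>i. (L1_modulus (s i) \<longlongrightarrow> 0) (at 0)"
    and f: "integrable lborel f"
    and lim: "(\<lambda>i. LINT x|lborel. norm (f x - s i x)) \<longlonglongrightarrow> 0"
  shows "(L1_modulus f \<longlongrightarrow> 0) (at 0)"
proof (rule order_tendstoI)
  fix e :: real assume "e > 0"
  then have "\<forall>\<^sub>F i in sequentially. (LINT x|lborel. norm (f x - s i x)) < e / 4"
    using lim by (intro order_tendstoD(2)) auto
  then obtain i where close: "(LINT x|lborel. norm (f x - s i x)) < e / 4"
    by (auto simp: eventually_sequentially)
  have "\<forall>\<^sub>F t in at 0. L1_modulus (s i) t < e / 2"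
    using \<open>e > 0\<close> by (intro order_tendstoD(2)[OF s(2)]) auto
  then show "\<forall>\<^sub>F t in at 0. L1_modulus f t < e"
  proof eventually_elim
    case (elim t)
    have "L1_modulus f t = L1_modulus (\<lambda>x. s i x + (f x - s i x)) t"
      by simp
    also have "\<dots> \<le> L1_modulus (s i) t + L1_modulus (\<lambda>x. f x - s i x) t"
      using s(1) f by (intro L1_modulus_add_le) auto
    also have "\<dots> \<le> L1_modulus (s i) t + 2 * (LINT x|lborel. norm (f x - s i x))"
      using s(1) f by (intro add_left_mono L1_modulus_le_twice_L1_norm) auto
    also have "\<dots> < e"
      using elim close by simp
    finally show ?case .
  qed
qed (use L1_modulus_nonneg less_le_trans in \<open>blast intro: always_eventually\<close>)

text \<open>By invariance of the measure, translation gains as much of \<open>A\<close> as it loses.\<close>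

lemma L1_modulus_indicator:
  fixes A :: "'n::euclidean_space set" and c :: "'a::{banach, second_countable_topology}"
  assumes [measurable]: "A \<in> sets borel" and "emeasure lborel A < \<infinity>"
  shows "L1_modulus (\<lambda>x. indicator A x *\<^sub>R c) t = 2 * measure lborel {x \<in> A. x + t \<notin> A} * norm c"
proof -
  let ?lost = "{x \<in> A. x + t \<notin> A}"
  have A: "integrable lborel (indicator A :: 'n \<Rightarrow> real)"
    using assms by (intro integrable_real_indicator) auto
  have lost: "integrable lborel (indicator ?lost :: 'n \<Rightarrow> real)"
    by (rule Bochner_Integration.integrable_bound[OF A]) (auto split: split_indicator)
  have "L1_modulus (\<lambda>x. indicator A x *\<^sub>R c) t
      = (LINT x|lborel. (2 * indicator ?lost x + (indicator A (x + t) - indicator A x)) * norm c)"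
    unfolding L1_modulus_def
    by (intro Bochner_Integration.integral_cong) (auto split: split_indicator)
  also have "\<dots> = (2 * (LINT x|lborel. indicator ?lost x)
      + ((LINT x|lborel. indicator A (x + t)) - (LINT x|lborel. indicator A x))) * norm c"
    using A lost integrable_translate[OF A, of t] by simp
  also have "\<dots> = 2 * measure lborel ?lost * norm c"
    using integral_translate[of "indicator A :: 'n \<Rightarrow> real" t] by simp
  finally show ?thesis .
qed

lemma measure_open_Diff_translate_tendsto_0:
  fixes U :: "'n::euclidean_space set"
  assumes U: "open U" "emeasure lborel U < \<infinity>"
  shows "((\<lambda>t. measure lborel {x \<in> U. x + t \<notin> U}) \<longlongrightarrow> 0) (at 0)"
  unfolding tendsto_at_iff_sequentially comp_def
proof safe
  fix t :: "nat \<Rightarrow> 'n" assume t: "t \<longlonglongrightarrow> 0"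
  have [measurable]: "U \<in> sets borel" using U by simp
  have "(\<lambda>k. LINT x|lborel. indicator {x \<in> U. x + t k \<notin> U} x :: real)
      \<longlonglongrightarrow> (LINT x|(lborel::'n measure). 0)"
  proof (rule integral_dominated_convergence)
    have "(\<lambda>k. indicator {x \<in> U. x + t k \<notin> U} x :: real) \<longlonglongrightarrow> 0" for x
    proof (cases "x \<in> U")
      case True
      have "(\<lambda>k. x + t k) \<longlonglongrightarrow> x"
        using tendsto_add[OF tendsto_const t] by simp
      then have "\<forall>\<^sub>F k in sequentially. x + t k \<in> U"
        using U(1) True by (rule topological_tendstoD)
      then show ?thesis
        by (intro tendsto_eventually) (auto elim: eventually_mono)
    qed simp
    then show "AE x in lborel. (\<lambda>k. indicator {x \<in> U. x + t k \<notin> U} x :: real) \<longlonglongrightarrow> 0"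
      by simp
    show "AE x in lborel. norm (indicator {x \<in> U. x + t k \<notin> U} x :: real) \<le> indicator U x" for k
      by (auto split: split_indicator)
    show "integrable lborel (indicator U :: 'n \<Rightarrow> real)"
      using U by (intro integrable_real_indicator) auto
  qed measurable
  then show "(\<lambda>k. measure lborel {x \<in> U. x + t k \<notin> U}) \<longlonglongrightarrow> 0"
    by simp
qed

lemma finite_measure_open_approximation:
  fixes A :: "'n::euclidean_space set"
  assumes A: "A \<in> sets borel" "emeasure lborel A < \<infinity>"
  obtains U :: "nat \<Rightarrow> 'n set" where "\<And>i. open (U i)" "\<And>i. A \<subseteq> U i"
    "\<And>i. emeasure lborel (U i) < \<infinity>" "(\<lambda>i. measure lborel (U i - A)) \<longlonglongrightarrow> 0"
proof -
  have "\<exists>U. open U \<and> A \<subseteq> U \<and> emeasure lborel (U - A) < ennreal (inverse (real (Suc i)))" for i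
    by (rule outer_regular_lborel[OF A(1), of "inverse (real (Suc i))"]) (simp, blast)
  then obtain U where U: "open (U i)" "A \<subseteq> U i"
    "emeasure lborel (U i - A) < ennreal (inverse (real (Suc i)))" for i
    by metis
  have finite: "emeasure lborel (U i) < \<infinity>" for i
  proof -
    have "emeasure lborel (U i) = emeasure lborel (A \<union> (U i - A))"
      using U(2) by (intro arg_cong[where f = "emeasure lborel"]) auto
    also have "\<dots> \<le> emeasure lborel A + emeasure lborel (U i - A)"
      using A(1) U(1) by (intro emeasure_subadditive) auto
    also have "\<dots> < \<infinity>"
      using A(2) U(3)[of i] by (auto simp: less_top[symmetric] top_unique)
    finally show ?thesis .
  qed
  have "measure lborel (U i - A) \<le> inverse (real (Suc i))" for i
    unfolding measure_def using U(3) by (intro enn2real_leI less_imp_le) auto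
  then have "(\<lambda>i. measure lborel (U i - A)) \<longlonglongrightarrow> 0"
    by (intro tendsto_sandwich[OF _ _ tendsto_const LIMSEQ_inverse_real_of_nat]) auto
  then show ?thesis
    using that U(1,2) finite by blast
qed

lemma L1_modulus_indicator_tendsto_0:
  fixes A :: "'n::euclidean_space set" and c :: "'a::{banach, second_countable_topology}"
  assumes [measurable]: "A \<in> sets borel" and finite: "emeasure lborel A < \<infinity>"
  shows "(L1_modulus (\<lambda>x. indicator A x *\<^sub>R c) \<longlongrightarrow> 0) (at 0)"
proof -
  obtain U :: "nat \<Rightarrow> 'n set" where U: "\<And>i. open (U i)" "\<And>i. A \<subseteq> U i"
    "\<And>i. emeasure lborel (U i) < \<infinity>" and lim: "(\<lambda>i. measure lborel (U i - A)) \<longlonglongrightarrow> 0"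
    using finite_measure_open_approximation[OF assms] by blast
  have [measurable]: "U i \<in> sets borel" for i using U(1) by simp
  show ?thesis
  proof (rule L1_modulus_tendsto_0_limit)
    show "integrable lborel (\<lambda>x. indicator (U i) x *\<^sub>R c)" for i
      using U(3) by simp
    show "integrable lborel (\<lambda>x. indicator A x *\<^sub>R c)"
      using finite by simp
    show "(L1_modulus (\<lambda>x. indicator (U i) x *\<^sub>R c) \<longlongrightarrow> 0) (at 0)" for i
      unfolding L1_modulus_indicator[OF \<open>U i \<in> sets borel\<close> U(3), abs_def]
      by (intro tendsto_mult_left_zero tendsto_mult_right_zero
          measure_open_Diff_translate_tendsto_0 U)
    have "norm (indicator A x *\<^sub>R c - indicator (U i) x *\<^sub>R c) = indicator (U i - A) x * norm c"
      for i x
      using U(2)[of i] by (auto split: split_indicator)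
    then show "(\<lambda>i. LINT x|lborel. norm (indicator A x *\<^sub>R c - indicator (U i) x *\<^sub>R c)) \<longlonglongrightarrow> 0"
      using tendsto_mult_left_zero[OF lim] by simp
  qed
qed

theorem L1_modulus_tendsto_0:
  fixes f :: "'n::euclidean_space \<Rightarrow> 'a::{banach, second_countable_topology}"
  assumes "integrable lborel f"
  shows "(L1_modulus f \<longlongrightarrow> 0) (at 0)"
  using assms
proof (induction rule: integrable_induct)
  case (base A c)
  then show ?case by (intro L1_modulus_indicator_tendsto_0) auto
next
  case (add f g)
  have "((\<lambda>t. L1_modulus f t + L1_modulus g t) \<longlongrightarrow> 0) (at 0)"
    using tendsto_add[OF add(3,4)] by simp
  then show ?case
    by (rule Lim_null_comparison[rotated])
      (use add(1,2) in \<open>auto intro!: always_eventually L1_modulus_add_le simp: L1_modulus_nonneg\<close>)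
next
  case (lim f s)
  have [measurable]: "f \<in> borel_measurable borel" "s i \<in> borel_measurable borel" for i
    using lim(1,4) by auto
  have "(\<lambda>i. LINT x|lborel. norm (f x - s i x)) \<longlonglongrightarrow> (LINT x|(lborel::'n measure). 0)"
  proof (rule integral_dominated_convergence)
    show "integrable lborel (\<lambda>x. 3 * norm (f x))"
      using lim(4) by simp
    have "norm (f x - s i x) \<le> 3 * norm (f x)" for i x
      using norm_triangle_ineq4[of "f x" "s i x"] lim(3)[of x i] by simp
    then show "AE x in lborel. norm (norm (f x - s i x)) \<le> 3 * norm (f x)" for i by simp
    have "(\<lambda>i. norm (f x - s i x)) \<longlonglongrightarrow> 0" for x
      using lim(2)[of x] by (auto intro!: tendsto_eq_intros)
    then show "AE x in lborel. (\<lambda>i. norm (f x - s i x)) \<longlonglongrightarrow> 0" by simp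
  qed auto
  then have "(\<lambda>i. LINT x|lborel. norm (f x - s i x)) \<longlonglongrightarrow> 0"
    by simp
  with lim(1,5,4) show ?case
    by (rule L1_modulus_tendsto_0_limit)
qed

lemma norm_diff_squared_le_norm_scaleR_diff:
  fixes a b :: "'a::real_inner"
  shows "(norm (a - b))\<^sup>2 \<le> 2 * norm (norm a *\<^sub>R a - norm b *\<^sub>R b)"
proof (cases "a = b")
  case False
  have polarization: "2 * (a \<bullet> b) = (norm a)\<^sup>2 + (norm b)\<^sup>2 - (norm (a - b))\<^sup>2"
    by (simp add: power2_norm_eq_inner inner_diff inner_commute)
  have "norm (a - b) * (norm (a - b))\<^sup>2 \<le> (norm a + norm b) * (norm (a - b))\<^sup>2"
    by (intro mult_right_mono norm_triangle_ineq4) simp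
  also have "\<dots> \<le> (norm a + norm b) * (norm (a - b))\<^sup>2 + (norm a + norm b) * (norm a - norm b)\<^sup>2"
    by simp
  also have "\<dots> = 2 * ((norm a *\<^sub>R a - norm b *\<^sub>R b) \<bullet> (a - b))"
  proof -
    have "2 * ((norm a *\<^sub>R a - norm b *\<^sub>R b) \<bullet> (a - b))
        = 2 * norm a ^ 3 + 2 * norm b ^ 3 - (norm a + norm b) * (2 * (a \<bullet> b))"
      by (simp add: inner_diff dot_square_norm inner_commute[of b a] power2_eq_square
          power3_eq_cube algebra_simps)
    then show ?thesis
      unfolding polarization by (simp add: power2_eq_square power3_eq_cube algebra_simps)
  qed
  also have "\<dots> \<le> norm (a - b) * (2 * norm (norm a *\<^sub>R a - norm b *\<^sub>R b))"
    using norm_cauchy_schwarz[of "norm a *\<^sub>R a - norm b *\<^sub>R b" "a - b"] by (simp add: mult_ac)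
  finally show ?thesis
    using False by simp
qed simp

text \<open>\<open>f \<mapsto> |f| f\<close> maps \<open>L\<^sub>2\<close> into \<open>L\<^sub>1\<close>, which reduces the claim to \<open>L\<^sub>1\<close>.\<close>

theorem L2_translation_tendsto_0:
  fixes f :: "'n::euclidean_space \<Rightarrow> 'a::euclidean_space"
  assumes [measurable]: "f \<in> borel_measurable borel"
    and f: "integrable lborel (\<lambda>x. (norm (f x))\<^sup>2)"
  shows "((\<lambda>t. LINT x|lborel. (norm (f (x + t) - f x))\<^sup>2) \<longlongrightarrow> 0) (at 0)"
proof (rule Lim_null_comparison)
  let ?g = "\<lambda>x. norm (f x) *\<^sub>R f x"
  have g: "integrable lborel ?g"
    by (rule iffD1[OF integrable_norm_iff]) (use f in \<open>auto simp: power2_eq_square\<close>)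
  have "(LINT x|lborel. (norm (f (x + t) - f x))\<^sup>2) \<le> 2 * L1_modulus ?g t" for t
    unfolding L1_modulus_def integral_mult_right_zero[symmetric]
    by (rule integral_mono') (use g integrable_translate[OF g, of t]
          norm_diff_squared_le_norm_scaleR_diff in auto)
  then show "\<forall>\<^sub>F t in at 0. norm (LINT x|lborel. (norm (f (x + t) - f x))\<^sup>2) \<le> 2 * L1_modulus ?g t"
    by simp
  show "((\<lambda>t. 2 * L1_modulus ?g t) \<longlongrightarrow> 0) (at 0)"
    using tendsto_mult_right_zero[OF L1_modulus_tendsto_0[OF g]] .
qed

section \<open>Square-integrable functions\<close>

lemma integrable_norm_mult:
  fixes f :: "'a \<Rightarrow> 'b::{banach, second_countable_topology}"
    and h :: "'a \<Rightarrow> 'c::{banach, second_countable_topology}"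
  assumes [measurable]: "f \<in> borel_measurable M" "h \<in> borel_measurable M"
    and "integrable M (\<lambda>x. (norm (f x))\<^sup>2)" "integrable M (\<lambda>x. (norm (h x))\<^sup>2)"
  shows "integrable M (\<lambda>x. norm (f x) * norm (h x))"
proof (rule Bochner_Integration.integrable_bound)
  show "integrable M (\<lambda>x. ((norm (f x))\<^sup>2 + (norm (h x))\<^sup>2) / 2)"
    using assms by simp
  have "norm a * norm b \<le> ((norm a)\<^sup>2 + (norm b)\<^sup>2) / 2" for a :: 'b and b :: 'c
    using sum_squares_bound[of "norm a" "norm b"] by simp
  then show "AE x in M. norm (norm (f x) * norm (h x)) \<le> norm (((norm (f x))\<^sup>2 + (norm (h x))\<^sup>2) / 2)"
    by simp
qed measurable

lemma Cauchy_Schwarz_integral: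
  fixes f :: "'a \<Rightarrow> 'b::{banach, second_countable_topology}"
    and h :: "'a \<Rightarrow> 'c::{banach, second_countable_topology}"
  assumes [measurable]: "f \<in> borel_measurable M" "h \<in> borel_measurable M"
    and f: "integrable M (\<lambda>x. (norm (f x))\<^sup>2)" and h: "integrable M (\<lambda>x. (norm (h x))\<^sup>2)"
  shows "(LINT x|M. norm (f x) * norm (h x))\<^sup>2
    \<le> (LINT x|M. (norm (f x))\<^sup>2) * (LINT x|M. (norm (h x))\<^sup>2)"
proof -
  have "ennreal ((LINT x|M. norm (f x) * norm (h x))\<^sup>2)
      = (\<integral>\<^sup>+x. ennreal (norm (f x)) * ennreal (norm (h x)) \<partial>M)\<^sup>2"
    using nn_integral_eq_integral[OF integrable_norm_mult[OF assms]]
    by (simp add: ennreal_mult ennreal_power)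
  also have "\<dots> \<le> (\<integral>\<^sup>+x. (ennreal (norm (f x)))\<^sup>2 \<partial>M) * (\<integral>\<^sup>+x. (ennreal (norm (h x)))\<^sup>2 \<partial>M)"
    by (rule Cauchy_Schwarz_nn_integral) measurable
  also have "\<dots> = ennreal ((LINT x|M. (norm (f x))\<^sup>2) * (LINT x|M. (norm (h x))\<^sup>2))"
    using nn_integral_eq_integral[OF f] nn_integral_eq_integral[OF h]
    by (simp add: ennreal_power ennreal_mult)
  finally show ?thesis
    by (subst (asm) ennreal_le_iff) simp_all
qed

lemma borel_measurable_cnj [measurable]: "cnj \<in> borel_measurable borel"
  by (intro borel_measurable_continuous_onI continuous_intros)

lemma integrable_cnj_mult:
  assumes [measurable]: "f \<in> borel_measurable M" "h \<in> borel_measurable M"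
    and "integrable M (\<lambda>x. (cmod (f x))\<^sup>2)" "integrable M (\<lambda>x. (cmod (h x))\<^sup>2)"
  shows "integrable M (\<lambda>x. cnj (f x) * h x)"
proof (rule iffD1[OF integrable_norm_iff])
  show "integrable M (\<lambda>x. norm (cnj (f x) * h x))"
    using integrable_norm_mult[OF assms] by (simp add: norm_mult)
qed measurable

lemma cmod_integral_cnj_mult_squared_le:
  assumes "f \<in> borel_measurable M" "h \<in> borel_measurable M"
    and "integrable M (\<lambda>x. (cmod (f x))\<^sup>2)" "integrable M (\<lambda>x. (cmod (h x))\<^sup>2)"
  shows "(cmod (LINT x|M. cnj (f x) * h x))\<^sup>2
    \<le> (LINT x|M. (cmod (f x))\<^sup>2) * (LINT x|M. (cmod (h x))\<^sup>2)"
proof -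
  have "cmod (LINT x|M. cnj (f x) * h x) \<le> (LINT x|M. cmod (f x) * cmod (h x))"
    using integral_norm_bound[of M "\<lambda>x. cnj (f x) * h x"] by (simp add: norm_mult)
  then have "(cmod (LINT x|M. cnj (f x) * h x))\<^sup>2 \<le> (LINT x|M. cmod (f x) * cmod (h x))\<^sup>2"
    by (rule power_mono) simp
  also note Cauchy_Schwarz_integral[OF assms]
  finally show ?thesis .
qed

lemma integrable_norm_diff_squared:
  fixes f h :: "'a \<Rightarrow> 'b::{banach, second_countable_topology}"
  assumes [measurable]: "f \<in> borel_measurable M" "h \<in> borel_measurable M"
    and "integrable M (\<lambda>x. (norm (f x))\<^sup>2)" "integrable M (\<lambda>x. (norm (h x))\<^sup>2)"
  shows "integrable M (\<lambda>x. (norm (f x - h x))\<^sup>2)"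
proof (rule Bochner_Integration.integrable_bound)
  show "integrable M (\<lambda>x. 2 * ((norm (f x))\<^sup>2 + (norm (h x))\<^sup>2))"
    using assms by simp
  have "(norm (a - b))\<^sup>2 \<le> 2 * ((norm a)\<^sup>2 + (norm b)\<^sup>2)" for a b :: 'b
  proof -
    have "(norm (a - b))\<^sup>2 \<le> (norm a + norm b)\<^sup>2"
      by (intro power_mono norm_triangle_ineq4) simp
    then show ?thesis
      using sum_squares_bound[of "norm a" "norm b"] by (simp add: power2_sum)
  qed
  then show "AE x in M. norm ((norm (f x - h x))\<^sup>2) \<le> norm (2 * ((norm (f x))\<^sup>2 + (norm (h x))\<^sup>2))"
    by simp
qed measurable

lemma L2_nrm_eq_0_iff:
  assumes "g \<in> L2_space"
  shows "L2_nrm g = 0 \<longleftrightarrow> (AE x in lebesgue. g x = 0)"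
proof -
  have "(LINT x|lebesgue. (cmod (g x))\<^sup>2) = 0 \<longleftrightarrow> (AE x in lebesgue. (cmod (g x))\<^sup>2 = 0)"
    using assms by (intro integral_nonneg_eq_0_iff_AE) (auto simp: L2_space_def)
  then show ?thesis
    by (simp add: L2_nrm_def)
qed

lemma L2_space_cmult:
  assumes "f \<in> L2_space"
  shows "(\<lambda>x. a * f x) \<in> L2_space"
proof -
  have [measurable]: "f \<in> borel_measurable lebesgue"
    using assms by (simp add: L2_space_def)
  have "(\<lambda>x. a * f x) \<in> borel_measurable lebesgue"
    by measurable
  then show ?thesis
    using assms by (simp add: L2_space_def norm_mult power_mult_distrib)
qed

lemma L2_inner_cmult: "L2_inner (\<lambda>x. a * f x) (\<lambda>x. b * h x) = cnj a * b * L2_inner f h"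
proof -
  have "L2_inner (\<lambda>x. a * f x) (\<lambda>x. b * h x) = (LINT x|lebesgue. (cnj a * b) * (cnj (f x) * h x))"
    by (simp add: L2_inner_def mult_ac)
  then show ?thesis
    by (simp only: integral_mult_right_zero L2_inner_def)
qed

lemma orthonormal_family_normalized:
  assumes "a \<noteq> 0" and "\<And>m n. L2_inner (\<phi> m) (\<phi> n) = (if m = n then complex_of_real (a\<^sup>2) else 0)"
  shows "orthonormal_family (\<lambda>n x. \<phi> n x / complex_of_real a)"
proof -
  have "L2_inner (\<lambda>x. \<phi> m x / complex_of_real a) (\<lambda>x. \<phi> n x / complex_of_real a)
      = L2_inner (\<phi> m) (\<phi> n) / complex_of_real (a\<^sup>2)" for m n
    using L2_inner_cmult[of "1 / complex_of_real a" "\<phi> m" "1 / complex_of_real a" "\<phi> n"]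
    by (simp add: power2_eq_square)
  then show ?thesis
    using assms by (simp add: orthonormal_family_def)
qed

section \<open>The Fourier transform on \<open>L\<^sub>1\<close>\<close>

lemma (in pair_sigma_finite) integrable_mult_kernel:
  fixes u :: "'a \<Rightarrow> 'c::{real_normed_field, banach, second_countable_topology}"
  assumes u: "integrable M1 u"
    and [measurable]: "case_prod k \<in> borel_measurable (M1 \<Otimes>\<^sub>M M2)"
    and k: "\<And>x. integrable M2 (k x)" "\<And>x. (LINT y|M2. norm (k x y)) \<le> C"
  shows "integrable (M1 \<Otimes>\<^sub>M M2) (\<lambda>(x, y). u x * k x y)"
proof (rule Fubini_integrable)
  have [measurable]: "u \<in> borel_measurable M1" using u by auto
  show "(\<lambda>(x, y). u x * k x y) \<in> borel_measurable (M1 \<Otimes>\<^sub>M M2)" by measurable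
  have "integrable M1 (\<lambda>x. norm (u x) * (LINT y|M2. norm (k x y)))"
  proof (rule Bochner_Integration.integrable_bound)
    show "integrable M1 (\<lambda>x. norm (u x) * C)" using u by simp
    show "AE x in M1. norm (norm (u x) * (LINT y|M2. norm (k x y))) \<le> norm (norm (u x) * C)"
      by (auto simp: abs_mult intro!: mult_left_mono order_trans[OF k(2) abs_ge_self])
  qed measurable
  then show "integrable M1 (\<lambda>x. LINT y|M2. norm (case (x, y) of (x, y) \<Rightarrow> u x * k x y))"
    by (simp add: norm_mult)
  show "AE x in M1. integrable M2 (\<lambda>y. case (x, y) of (x, y) \<Rightarrow> u x * k x y)"
    using k(1) by simp
qed

definition fourier :: "(real \<Rightarrow> complex) \<Rightarrow> real \<Rightarrow> complex" where
  "fourier f x = (LINT \<xi>|lebesgue. iexp (x * \<xi>) * f \<xi>)"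

lemma fourier_eq_lborel:
  assumes [measurable]: "f \<in> borel_measurable borel"
  shows "fourier f x = (LINT \<xi>|lborel. iexp (x * \<xi>) * f \<xi>)"
  unfolding fourier_def by (rule integral_completion) measurable

lemma borel_measurable_fourier [measurable]:
  assumes [measurable]: "f \<in> borel_measurable borel"
  shows "fourier f \<in> borel_measurable borel"
  unfolding fourier_eq_lborel[OF assms, abs_def] by measurable

lemma integrable_iexp_mult:
  assumes f: "integrable lborel f"
  shows "integrable lborel (\<lambda>\<xi>. iexp (x * \<xi>) * f \<xi>)"
proof (rule Bochner_Integration.integrable_bound[OF f])
  have "f \<in> borel_measurable borel" using f by auto
  then show "(\<lambda>\<xi>. iexp (x * \<xi>) * f \<xi>) \<in> borel_measurable lborel" by measurable
qed (simp add: norm_mult)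

lemma cmod_fourier_le:
  assumes "integrable lborel f"
  shows "cmod (fourier f x) \<le> (LINT \<xi>|lborel. cmod (f \<xi>))"
proof -
  have "f \<in> borel_measurable borel" using assms by auto
  then show ?thesis
    using integral_norm_bound[of lborel "\<lambda>\<xi>. iexp (x * \<xi>) * f \<xi>"]
    by (simp add: fourier_eq_lborel norm_mult)
qed

lemma fourier_multiplication:
  assumes u: "integrable lborel u" and v: "integrable lborel v"
  shows "(LINT x|lborel. u x * fourier v x) = (LINT x|lborel. fourier u x * v x)"
proof -
  have [measurable]: "u \<in> borel_measurable borel" "v \<in> borel_measurable borel"
    using u v by auto
  have "integrable (lborel \<Otimes>\<^sub>M lborel) (\<lambda>(x, y). u x * (iexp (x * y) * v y))"
    by (rule lborel_pair.integrable_mult_kernel[OF u _ integrable_iexp_mult[OF v],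
          where C="LINT y|lborel. cmod (v y)"]) (simp_all add: norm_mult)
  then have "(LINT x|lborel. LINT y|lborel. u x * (iexp (x * y) * v y))
      = (LINT y|lborel. LINT x|lborel. u x * (iexp (x * y) * v y))"
    using lborel_pair.Fubini_integral by fastforce
  also have "\<dots> = (LINT y|lborel. LINT x|lborel. (iexp (y * x) * u x) * v y)"
    by (simp add: mult_ac)
  finally show ?thesis
    by (simp add: fourier_eq_lborel)
qed

definition cross_correlation :: "(real \<Rightarrow> complex) \<Rightarrow> (real \<Rightarrow> complex) \<Rightarrow> real \<Rightarrow> complex" where
  "cross_correlation f h t = (LINT x|lborel. cnj (f x) * h (x + t))"

lemma cross_correlation_0: "cross_correlation f h 0 = (LINT x|lborel. cnj (f x) * h x)"
  by (simp add: cross_correlation_def)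

lemma cross_correlation_pair_integrable:
  assumes f: "integrable lborel f" and h: "integrable lborel h"
  shows "integrable (lborel \<Otimes>\<^sub>M lborel) (\<lambda>(y, t). cnj (f y) * h (y + t))"
proof (rule lborel_pair.integrable_mult_kernel)
  have [measurable]: "h \<in> borel_measurable borel" using h by auto
  show "integrable lborel (\<lambda>t. h (y + t))" for y
    using integrable_translate[OF h, of y] by (simp add: add.commute)
  show "(LINT t|lborel. norm (h (y + t))) \<le> (LINT t|lborel. norm (h t))" for y
    using integral_translate[of "\<lambda>t. norm (h t)" y] by (simp add: add.commute)
  show "(\<lambda>(y, t). h (y + t)) \<in> borel_measurable (lborel \<Otimes>\<^sub>M lborel)" by measurable
qed (use f in simp)

lemma integrable_cross_correlation:
  assumes "integrable lborel f" "integrable lborel h"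
  shows "integrable lborel (cross_correlation f h)"
  using lborel_pair.integrable_snd[OF cross_correlation_pair_integrable[OF assms]]
  by (simp add: cross_correlation_def[abs_def])

lemma fourier_cross_correlation:
  assumes f: "integrable lborel f" and h: "integrable lborel h"
  shows "fourier (cross_correlation f h) x = cnj (fourier f x) * fourier h x"
proof -
  have [measurable]: "f \<in> borel_measurable borel" "h \<in> borel_measurable borel"
    using f h by auto
  have [measurable]: "cross_correlation f h \<in> borel_measurable borel"
    using integrable_cross_correlation[OF f h] by auto
  have integrable: "integrable (lborel \<Otimes>\<^sub>M lborel)
      (\<lambda>(y, t). iexp (x * t) * (cnj (f y) * h (y + t)))"
    by (rule Bochner_Integration.integrable_bound[OF cross_correlation_pair_integrable[OF f h]])
      (auto simp: norm_mult)
  have "fourier (cross_correlation f h) x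
      = (LINT t|lborel. LINT y|lborel. iexp (x * t) * (cnj (f y) * h (y + t)))"
    by (simp add: fourier_eq_lborel cross_correlation_def)
  also have "\<dots> = (LINT y|lborel. LINT t|lborel. iexp (x * t) * (cnj (f y) * h (y + t)))"
    using lborel_pair.Fubini_integral[OF integrable] by simp
  also have "\<dots> = (LINT y|lborel. cnj (iexp (x * y) * f y) * fourier h x)"
  proof (intro Bochner_Integration.integral_cong refl)
    fix y
    have "iexp (x * t) = cnj (iexp (x * y)) * iexp (x * (t + y))" for t
      by (simp add: exp_cnj flip: exp_add) (simp add: algebra_simps)
    then have "(LINT t|lborel. iexp (x * t) * (cnj (f y) * h (y + t)))
        = (LINT t|lborel. cnj (iexp (x * y) * f y) * (iexp (x * (t + y)) * h (t + y)))"
      by (simp add: mult_ac add.commute)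
    also have "\<dots> = cnj (iexp (x * y) * f y) * fourier h x"
      using integral_translate[of "\<lambda>t. iexp (x * t) * h t" y]
      by (simp only: fourier_eq_lborel \<open>h \<in> borel_measurable borel\<close> integral_mult_right_zero)
        measurable
    finally show "(LINT t|lborel. iexp (x * t) * (cnj (f y) * h (y + t)))
        = cnj (iexp (x * y) * f y) * fourier h x" .
  qed
  also have "\<dots> = cnj (fourier f x) * fourier h x"
    by (simp only: integral_mult_left_zero Bochner_Integration.integral_cnj
        fourier_eq_lborel \<open>f \<in> borel_measurable borel\<close>)
  finally show ?thesis .
qed

lemma bounded_cross_correlation:
  assumes [measurable]: "f \<in> borel_measurable borel" "h \<in> borel_measurable borel"
    and f: "integrable lborel (\<lambda>x. (cmod (f x))\<^sup>2)" and h: "integrable lborel (\<lambda>x. (cmod (h x))\<^sup>2)"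
  shows "bounded (range (cross_correlation f h))"
proof -
  have "(cmod (cross_correlation f h t))\<^sup>2
      \<le> (LINT x|lborel. (cmod (f x))\<^sup>2) * (LINT x|lborel. (cmod (h x))\<^sup>2)" for t
    using cmod_integral_cnj_mult_squared_le[of f lborel "\<lambda>x. h (x + t)"] f
      integrable_translate[OF h, of t] integral_translate[of "\<lambda>x. (cmod (h x))\<^sup>2" t]
    by (simp add: cross_correlation_def)
  then show ?thesis
    unfolding bounded_iff by (blast intro: real_le_rsqrt)
qed

lemma isCont_cross_correlation_0:
  assumes [measurable]: "f \<in> borel_measurable borel" "h \<in> borel_measurable borel"
    and f: "integrable lborel (\<lambda>x. (cmod (f x))\<^sup>2)" and h: "integrable lborel (\<lambda>x. (cmod (h x))\<^sup>2)"
  shows "isCont (cross_correlation f h) 0"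
proof -
  define F where "F = (LINT x|lborel. (cmod (f x))\<^sup>2)"
  define H where "H t = (LINT x|lborel. (cmod (h (x + t) - h x))\<^sup>2)" for t
  have difference_le: "cmod (cross_correlation f h t - cross_correlation f h 0) \<le> sqrt (F * H t)"
    for t
  proof -
    note h_translate = integrable_translate[OF h, of t]
    have diff: "integrable lborel (\<lambda>x. (cmod (h (x + t) - h x))\<^sup>2)"
      using h h_translate by (intro integrable_norm_diff_squared) measurable
    have "cross_correlation f h t - cross_correlation f h 0
        = (LINT x|lborel. cnj (f x) * h (x + t) - cnj (f x) * h x)"
      unfolding cross_correlation_def add_0_right
      by (intro Bochner_Integration.integral_diff[symmetric] integrable_cnj_mult f h h_translate)
        measurable
    then show ?thesis
      using cmod_integral_cnj_mult_squared_le[OF _ _ f diff]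
      by (simp add: F_def H_def right_diff_distrib real_le_rsqrt)
  qed
  have "((\<lambda>t. sqrt (F * H t)) \<longlongrightarrow> 0) (at 0)"
    using tendsto_real_sqrt[OF tendsto_mult_right_zero[OF L2_translation_tendsto_0[OF _ h], of F]]
    by (simp add: H_def)
  then have "((\<lambda>t. cross_correlation f h t - cross_correlation f h 0) \<longlongrightarrow> 0) (at 0)"
    by (rule Lim_null_comparison[rotated]) (simp add: difference_le)
  then show ?thesis
    unfolding isCont_def by (rule LIM_zero_cancel)
qed

section \<open>Fourier inversion at the origin and Parseval's identity\<close>

lemma integrable_gaussian_dilation:
  assumes "e > 0"
  shows "integrable lborel (\<lambda>x. std_normal_density (e * x))"
  using lborel_integrable_real_affine[of std_normal_density e 0] assms by simp

lemma fourier_gaussian_dilation: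
  assumes "e > 0"
  shows "fourier (\<lambda>x. complex_of_real (std_normal_density (e * x))) s
    = complex_of_real (sqrt (2 * pi) / e * std_normal_density (s / e))"
proof -
  have "complex_of_real (sqrt (2 * pi) * std_normal_density (s / e))
      = char std_normal_distribution (s / e)"
    unfolding char_std_normal_distribution by (simp add: std_normal_density_def)
  also have "\<dots> = (LINT y|lborel. iexp (s / e * y) * complex_of_real (std_normal_density y))"
    unfolding char_def by (subst integral_density) (auto simp: scaleR_conv_of_real mult.commute)
  also have "\<dots> = e *\<^sub>R (LINT x|lborel.
      iexp (s / e * (e * x)) * complex_of_real (std_normal_density (e * x)))"
    using assms by (subst lborel_integral_real_affine[of e _ 0]) auto
  also have "\<dots> = complex_of_real e * fourier (\<lambda>x. complex_of_real (std_normal_density (e * x))) s"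
    using assms by (simp add: fourier_eq_lborel scaleR_conv_of_real)
  finally show ?thesis
    using assms by (simp add: field_simps)
qed

lemma gaussian_mean_fourier:
  fixes A :: "real \<Rightarrow> complex"
  assumes A: "integrable lborel A" and e: "e > 0"
  shows "(LINT x|lborel. complex_of_real (std_normal_density (e * x)) * fourier A x)
    = sqrt (2 * pi) * (LINT s|lborel. complex_of_real (std_normal_density s) * A (e * s))"
proof -
  let ?G = "\<lambda>s. complex_of_real (sqrt (2 * pi) / e * std_normal_density (s / e))"
  have "(LINT x|lborel. complex_of_real (std_normal_density (e * x)) * fourier A x)
      = (LINT s|lborel. ?G s * A s)"
    using e by (subst fourier_multiplication)
      (simp_all only: A integrable_of_real integrable_gaussian_dilation fourier_gaussian_dilation)
  also have "\<dots> = e *\<^sub>R (LINT s|lborel. ?G (e * s) * A (e * s))"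
    using lborel_integral_real_affine[of e "\<lambda>s. ?G s * A s" 0] e by simp
  also have "\<dots> = (LINT s|lborel. sqrt (2 * pi) * (complex_of_real (std_normal_density s) * A (e * s)))"
    unfolding integral_scaleR_right[symmetric]
    using e by (intro Bochner_Integration.integral_cong) (auto simp: scaleR_conv_of_real)
  finally show ?thesis
    by simp
qed

lemma gaussian_mean_tendsto:
  fixes A :: "real \<Rightarrow> complex"
  assumes [measurable]: "A \<in> borel_measurable borel"
    and A: "bounded (range A)" "isCont A 0" and e: "e \<longlonglongrightarrow> 0"
  shows "(\<lambda>k. LINT s|lborel. complex_of_real (std_normal_density s) * A (e k * s)) \<longlonglongrightarrow> A 0"
proof -
  obtain B where A_bound: "cmod (A t) \<le> B" for t
    using A(1) by (auto simp: bounded_iff)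
  have "(\<lambda>k. LINT s|lborel. complex_of_real (std_normal_density s) * A (e k * s))
      \<longlonglongrightarrow> (LINT s|lborel. complex_of_real (std_normal_density s) * A 0)"
  proof (rule integral_dominated_convergence)
    show "integrable lborel (\<lambda>s. std_normal_density s * B)" by simp
    show "AE s in lborel. norm (complex_of_real (std_normal_density s) * A (e k * s))
        \<le> std_normal_density s * B" for k
      using A_bound by (auto simp: norm_mult intro!: mult_left_mono)
    have "(\<lambda>k. A (e k * s)) \<longlonglongrightarrow> A 0" for s
      using A(2) tendsto_mult_left_zero[OF e] by (rule isCont_tendsto_compose)
    then show "AE s in lborel. (\<lambda>k. complex_of_real (std_normal_density s) * A (e k * s))
        \<longlonglongrightarrow> complex_of_real (std_normal_density s) * A 0"
      by (intro AE_I2 tendsto_intros)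
  qed measurable
  then show ?thesis by simp
qed

definition gaussian_weight :: "nat \<Rightarrow> real \<Rightarrow> real" where
  "gaussian_weight k x = std_normal_density (inverse (real (Suc k)) * x)"

lemma borel_measurable_gaussian_weight [measurable]: "gaussian_weight k \<in> borel_measurable borel"
  unfolding gaussian_weight_def[abs_def] by measurable

lemma integrable_gaussian_weight: "integrable lborel (gaussian_weight k)"
  unfolding gaussian_weight_def[abs_def] by (rule integrable_gaussian_dilation) simp

lemma gaussian_weight_nonneg: "0 \<le> gaussian_weight k x"
  by (simp add: gaussian_weight_def)

lemma gaussian_weight_le: "gaussian_weight k x \<le> 1 / sqrt (2 * pi)"
  by (simp add: gaussian_weight_def std_normal_density_def divide_right_mono)

lemma gaussian_weight_mono:
  assumes "i \<le> j"
  shows "gaussian_weight i x \<le> gaussian_weight j x"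
proof -
  have "(inverse (real (Suc j)) * x)\<^sup>2 \<le> (inverse (real (Suc i)) * x)\<^sup>2"
    unfolding power_mult_distrib using assms
    by (intro mult_right_mono power_mono le_imp_inverse_le) auto
  then show ?thesis
    by (simp add: gaussian_weight_def std_normal_density_def divide_right_mono)
qed

lemma gaussian_weight_tendsto: "(\<lambda>k. gaussian_weight k x) \<longlonglongrightarrow> 1 / sqrt (2 * pi)"
proof -
  have "(\<lambda>k. gaussian_weight k x) \<longlonglongrightarrow> 1 / sqrt (2 * pi) * exp (- (0 * x)\<^sup>2 / 2)"
    unfolding gaussian_weight_def std_normal_density_def
    by (intro tendsto_intros LIMSEQ_inverse_real_of_nat) simp
  then show ?thesis by simp
qed

lemma gaussian_weight_mean_fourier_tendsto:
  fixes A :: "real \<Rightarrow> complex"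
  assumes "integrable lborel A" "bounded (range A)" "isCont A 0"
  shows "(\<lambda>k. LINT x|lborel. complex_of_real (gaussian_weight k x) * fourier A x)
    \<longlonglongrightarrow> sqrt (2 * pi) * A 0"
proof -
  have scale_pos: "inverse (real (Suc k)) > 0" for k
    by simp
  show ?thesis
    unfolding gaussian_weight_def gaussian_mean_fourier[OF assms(1) scale_pos] using assms
    by (intro tendsto_mult_left gaussian_mean_tendsto LIMSEQ_inverse_real_of_nat) auto
qed

lemma of_real_sqrt_mult_self:
  "0 \<le> a \<Longrightarrow> of_real (sqrt a) * of_real (sqrt a) = (of_real a :: 'a::real_algebra_1)"
  by (simp flip: of_real_mult)

lemma integral_fourier:
  fixes A :: "real \<Rightarrow> complex"
  assumes A: "integrable lborel A" "bounded (range A)" "isCont A 0"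
    and fourier_integrable: "integrable lborel (fourier A)"
  shows "(LINT x|lborel. fourier A x) = 2 * pi * A 0"
proof -
  have [measurable]: "A \<in> borel_measurable borel" using A by auto
  let ?F = "\<lambda>k x. complex_of_real (gaussian_weight k x) * fourier A x"
  have "(\<lambda>k. LINT x|lborel. ?F k x)
      \<longlonglongrightarrow> (LINT x|lborel. complex_of_real (1 / sqrt (2 * pi)) * fourier A x)"
  proof (rule integral_dominated_convergence)
    show "integrable lborel (\<lambda>x. 1 / sqrt (2 * pi) * cmod (fourier A x))"
      using fourier_integrable by simp
    show "AE x in lborel. norm (?F k x) \<le> 1 / sqrt (2 * pi) * cmod (fourier A x)" for k
      using gaussian_weight_le by (intro AE_I2) (simp only: norm_mult norm_of_real
          abs_of_nonneg gaussian_weight_nonneg mult_right_mono norm_ge_zero)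
    show "AE x in lborel. (\<lambda>k. ?F k x) \<longlonglongrightarrow> complex_of_real (1 / sqrt (2 * pi)) * fourier A x"
      by (intro AE_I2 tendsto_intros gaussian_weight_tendsto)
  qed measurable
  then have "(LINT x|lborel. complex_of_real (1 / sqrt (2 * pi)) * fourier A x) = sqrt (2 * pi) * A 0"
    using gaussian_weight_mean_fourier_tendsto[OF A] by (rule LIMSEQ_unique)
  then have "(LINT x|lborel. fourier A x)
      = complex_of_real (sqrt (2 * pi)) * complex_of_real (sqrt (2 * pi)) * A 0"
    by (simp add: field_simps)
  then show ?thesis
    by (simp only: of_real_sqrt_mult_self pi_ge_zero mult_nonneg_nonneg zero_le_numeral)
qed

lemma integrable_fourier_nonneg:
  fixes A :: "real \<Rightarrow> complex"
  assumes A: "integrable lborel A" "bounded (range A)" "isCont A 0"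
    and \<phi>: "\<And>x. fourier A x = complex_of_real (\<phi> x)" "\<And>x. 0 \<le> \<phi> x"
  shows "integrable lborel \<phi>"
proof -
  have [measurable]: "A \<in> borel_measurable borel" using A by auto
  have "(\<lambda>x. Re (fourier A x)) \<in> borel_measurable borel" by measurable
  then have [measurable]: "\<phi> \<in> borel_measurable borel"
    using \<phi>(1) by simp
  let ?F = "\<lambda>k x. gaussian_weight k x * \<phi> x"
  have "integrable lborel (\<lambda>x. 1 / sqrt (2 * pi) * \<phi> x)"
  proof (rule integrable_monotone_convergence)
    show "integrable lborel (?F k)" for k
    proof (rule Bochner_Integration.integrable_bound)
      show "integrable lborel (\<lambda>x. gaussian_weight k x * (LINT \<xi>|lborel. cmod (A \<xi>)))"
        using integrable_gaussian_weight by simp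
      have "\<phi> x \<le> (LINT \<xi>|lborel. cmod (A \<xi>))" for x
        using cmod_fourier_le[OF A(1), of x] \<phi> by simp
      then show "AE x in lborel. norm (?F k x)
          \<le> norm (gaussian_weight k x * (LINT \<xi>|lborel. cmod (A \<xi>)))"
        using \<phi>(2) gaussian_weight_nonneg by (auto simp: abs_mult intro!: mult_left_mono)
    qed measurable
    show "AE x in lborel. mono (\<lambda>k. ?F k x)"
      using \<phi>(2) by (intro AE_I2 monoI mult_right_mono gaussian_weight_mono)
    show "AE x in lborel. (\<lambda>k. ?F k x) \<longlonglongrightarrow> 1 / sqrt (2 * pi) * \<phi> x"
      by (intro AE_I2 tendsto_intros gaussian_weight_tendsto)
    have "(\<lambda>k. LINT x|lborel. complex_of_real (?F k x)) \<longlonglongrightarrow> sqrt (2 * pi) * A 0"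
      using gaussian_weight_mean_fourier_tendsto[OF A] by (simp add: \<phi>(1))
    then show "(\<lambda>k. LINT x|lborel. ?F k x) \<longlonglongrightarrow> Re (sqrt (2 * pi) * A 0)"
      unfolding integral_complex_of_real using tendsto_Re by fastforce
  qed measurable
  then show ?thesis by (subst (asm) integrable_mult_left_iff) simp
qed

lemma integrable_fourier_squared:
  assumes f: "integrable lborel f" "integrable lborel (\<lambda>x. (cmod (f x))\<^sup>2)"
  shows "integrable lborel (\<lambda>x. (cmod (fourier f x))\<^sup>2)"
proof (rule integrable_fourier_nonneg)
  show "integrable lborel (cross_correlation f f)"
    using f by (intro integrable_cross_correlation)
  show "bounded (range (cross_correlation f f))" "isCont (cross_correlation f f) 0"
    using f by (auto intro: bounded_cross_correlation isCont_cross_correlation_0)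
  show "fourier (cross_correlation f f) x = complex_of_real ((cmod (fourier f x))\<^sup>2)" for x
    unfolding fourier_cross_correlation[OF f(1) f(1)] complex_norm_square by (rule mult.commute)
qed simp

lemma parseval_lborel:
  assumes f: "integrable lborel f" "integrable lborel (\<lambda>x. (cmod (f x))\<^sup>2)"
    and h: "integrable lborel h" "integrable lborel (\<lambda>x. (cmod (h x))\<^sup>2)"
  shows "(LINT x|lborel. cnj (fourier f x) * fourier h x) = 2 * pi * (LINT x|lborel. cnj (f x) * h x)"
proof -
  have [measurable]: "f \<in> borel_measurable borel" "h \<in> borel_measurable borel"
    using f h by auto
  have "integrable lborel (\<lambda>x. cnj (fourier f x) * fourier h x)"
    by (intro integrable_cnj_mult integrable_fourier_squared f h) measurable
  then have "integrable lborel (fourier (cross_correlation f h))"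
    by (simp add: fourier_cross_correlation[OF f(1) h(1), abs_def])
  then have "(LINT x|lborel. fourier (cross_correlation f h) x) = 2 * pi * cross_correlation f h 0"
    using f h by (intro integral_fourier integrable_cross_correlation bounded_cross_correlation
        isCont_cross_correlation_0) auto
  then show ?thesis
    by (simp add: fourier_cross_correlation[OF f(1) h(1)] cross_correlation_0)
qed

lemma borel_measurable_lebesgue_AE_eq_borel:
  fixes f :: "real \<Rightarrow> complex"
  assumes "f \<in> borel_measurable lebesgue"
  obtains f' where "f' \<in> borel_measurable borel" "AE x in lebesgue. f x = f' x"
proof -
  have "(\<lambda>x. Re (f x)) \<in> borel_measurable lebesgue" "(\<lambda>x. Im (f x)) \<in> borel_measurable lebesgue"
    using assms by auto
  from this[THEN completion_ex_borel_measurable_real] obtain a b where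
    [measurable]: "a \<in> borel_measurable borel" "b \<in> borel_measurable borel"
    and ab: "AE x in lborel. Re (f x) = a x" "AE x in lborel. Im (f x) = b x"
    by auto
  have "AE x in lebesgue. f x = Complex (a x) (b x)"
    using ab[THEN AE_completion] by eventually_elim (simp add: complex_eq_iff)
  moreover have "(\<lambda>x. Complex (a x) (b x)) \<in> borel_measurable borel"
    unfolding Complex_eq by measurable
  ultimately show ?thesis using that by blast
qed

lemma borel_measurable_iexp_mult:
  assumes f: "f \<in> borel_measurable lebesgue"
  shows "(\<lambda>\<xi>. iexp (x * \<xi>) * f \<xi>) \<in> borel_measurable lebesgue"
proof (rule borel_measurable_times[OF _ f])
  show "(\<lambda>\<xi>. iexp (x * \<xi>)) \<in> borel_measurable lebesgue"
    by (rule measurable_completion) measurable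
qed

lemma L1_L2_borel_representative:
  assumes f: "f \<in> L2_space" "integrable lebesgue f"
  obtains f' where "integrable lborel f'" "integrable lborel (\<lambda>x. (cmod (f' x))\<^sup>2)"
    "AE x in lebesgue. f x = f' x" "fourier f = fourier f'"
proof -
  have f_meas: "f \<in> borel_measurable lebesgue" and f2: "integrable lebesgue (\<lambda>x. (cmod (f x))\<^sup>2)"
    using f by (auto simp: L2_space_def)
  obtain f' where f' [measurable]: "f' \<in> borel_measurable borel"
    and representative: "AE x in lebesgue. f x = f' x"
    using borel_measurable_lebesgue_AE_eq_borel[OF f_meas] by blast
  have f'_meas [measurable]: "f' \<in> borel_measurable lebesgue"
    using f' by (simp add: measurable_completion)
  show ?thesis
  proof (rule that)
    have "integrable lebesgue f'"
      using f(2) f'_meas representative by (rule integrable_cong_AE_imp)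
    then show "integrable lborel f'"
      by (simp add: integrable_completion)
    have "integrable lebesgue (\<lambda>x. (cmod (f' x))\<^sup>2)"
      using f2 by (rule integrable_cong_AE_imp) (use representative in \<open>auto elim: eventually_mono\<close>)
    then show "integrable lborel (\<lambda>x. (cmod (f' x))\<^sup>2)"
      by (simp add: integrable_completion)
    show "fourier f = fourier f'"
    proof
      fix x
      show "fourier f x = fourier f' x"
        unfolding fourier_def using representative
        by (intro integral_cong_AE borel_measurable_iexp_mult f_meas f'_meas)
          (auto elim: eventually_mono)
    qed
  qed (rule representative)
qed

theorem fourier_L2_space:
  assumes "f \<in> L2_space" "integrable lebesgue f"
  shows "fourier f \<in> L2_space"
proof -
  obtain f' where f': "integrable lborel f'" "integrable lborel (\<lambda>x. (cmod (f' x))\<^sup>2)"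
    "fourier f = fourier f'"
    using L1_L2_borel_representative[OF assms] by blast
  have [measurable]: "f' \<in> borel_measurable borel" using f'(1) by auto
  have "fourier f' \<in> borel_measurable lebesgue"
    by (rule measurable_completion) measurable
  then show ?thesis
    using integrable_fourier_squared[OF f'(1,2)]
    by (simp add: L2_space_def f'(3) integrable_completion)
qed

theorem parseval:
  assumes f: "f \<in> L2_space" "integrable lebesgue f" and h: "h \<in> L2_space" "integrable lebesgue h"
  shows "L2_inner (fourier f) (fourier h) = 2 * pi * L2_inner f h"
proof -
  obtain f' where f': "integrable lborel f'" "integrable lborel (\<lambda>x. (cmod (f' x))\<^sup>2)"
    and ff': "AE x in lebesgue. f x = f' x" "fourier f = fourier f'"
    using L1_L2_borel_representative[OF f] by blast
  obtain h' where h': "integrable lborel h'" "integrable lborel (\<lambda>x. (cmod (h' x))\<^sup>2)"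
    and hh': "AE x in lebesgue. h x = h' x" "fourier h = fourier h'"
    using L1_L2_borel_representative[OF h] by blast
  have [measurable]: "f' \<in> borel_measurable borel" "h' \<in> borel_measurable borel"
    using f'(1) h'(1) by auto
  have [measurable]: "f \<in> borel_measurable lebesgue" "h \<in> borel_measurable lebesgue"
    using f(2) h(2) by auto
  have product_measurable: "(\<lambda>x. cnj (f' x) * h' x) \<in> borel_measurable lebesgue"
    by (rule measurable_completion) measurable
  have "L2_inner (fourier f) (fourier h) = (LINT x|lborel. cnj (fourier f' x) * fourier h' x)"
    unfolding L2_inner_def ff'(2) hh'(2) by (rule integral_completion) measurable
  also have "\<dots> = 2 * pi * (LINT x|lborel. cnj (f' x) * h' x)"
    by (rule parseval_lborel[OF f' h'])
  also have "(LINT x|lborel. cnj (f' x) * h' x) = (LINT x|lebesgue. cnj (f' x) * h' x)"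
    by (rule integral_completion[symmetric]) measurable
  also have "\<dots> = L2_inner f h"
    unfolding L2_inner_def using ff'(1) hh'(1)
    by (intro integral_cong_AE product_measurable) (measurable, auto elim: eventually_elim2)
  finally show ?thesis .
qed

section \<open>Polynomial multiples of rapidly decreasing functions\<close>

definition rapidly_decreasing :: "(real \<Rightarrow> complex) \<Rightarrow> bool" where
  "rapidly_decreasing g \<longleftrightarrow> (\<forall>n. ((\<lambda>\<xi>. cmod (complex_of_real (\<xi> ^ n) * g \<xi>)) \<longlongrightarrow> 0) at_infinity)"

definition poly_times :: "real poly \<Rightarrow> (real \<Rightarrow> complex) \<Rightarrow> real \<Rightarrow> complex" where
  "poly_times q g \<xi> = complex_of_real (poly q \<xi>) * g \<xi>"

lemma borel_measurable_poly_lebesgue [measurable]: "poly (q :: real poly) \<in> borel_measurable lebesgue"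
  by (intro measurable_completion) (simp add: borel_measurable_continuous_onI continuous_intros)

lemma borel_measurable_poly_times [measurable]:
  assumes [measurable]: "g \<in> borel_measurable lebesgue"
  shows "poly_times q g \<in> borel_measurable lebesgue"
  unfolding poly_times_def[abs_def] by measurable

lemma poly_times_tendsto_0:
  assumes "rapidly_decreasing g"
  shows "(poly_times q g \<longlongrightarrow> 0) at_infinity"
proof -
  have "((\<lambda>\<xi>. complex_of_real (\<xi> ^ n) * g \<xi>) \<longlongrightarrow> 0) at_infinity" for n
    using assms unfolding rapidly_decreasing_def by (auto intro: tendsto_norm_zero_cancel)
  then have "((\<lambda>\<xi>. \<Sum>n\<le>degree q. complex_of_real (coeff q n) * (complex_of_real (\<xi> ^ n) * g \<xi>))
      \<longlongrightarrow> 0) at_infinity"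
    by (intro tendsto_null_sum tendsto_mult_right_zero)
  then show ?thesis
    by (simp add: poly_times_def[abs_def] poly_altdef sum_distrib_right mult.assoc)
qed

lemma integrable_lebesgue_inverse_1_plus_square:
  "integrable lebesgue (\<lambda>x::real. inverse (1 + x\<^sup>2))"
proof -
  have "integrable lborel (\<lambda>x::real. inverse (1 + x\<^sup>2))"
    using integrable_inverse_1_plus_square
    by (simp add: set_integrable_def einterval_def)
  then show ?thesis
    by (simp add: integrable_completion)
qed

lemma rapidly_decreasing_poly_times_bound:
  assumes "rapidly_decreasing g"
  obtains C where "\<And>\<xi>. (cmod (poly_times q g \<xi>))\<^sup>2 \<le> C\<^sup>2 * (cmod (g \<xi>))\<^sup>2 + inverse (1 + \<xi>\<^sup>2)"
proof -
  have "\<forall>\<^sub>F \<xi> in at_infinity. cmod (poly_times ([:1, 0, 1:] * q) g \<xi>) < 1"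
    using tendsto_norm_zero[OF poly_times_tendsto_0[OF assms]] by (rule order_tendstoD) simp
  then obtain b where outside: "cmod (poly_times ([:1, 0, 1:] * q) g \<xi>) < 1" if "\<bar>\<xi>\<bar> \<ge> b" for \<xi>
    by (auto simp: eventually_at_infinity)
  have "bounded (poly q ` {-b..b})"
    by (intro compact_imp_bounded compact_continuous_image continuous_intros compact_Icc)
  then obtain C where "\<forall>\<xi>\<in>{-b..b}. \<bar>poly q \<xi>\<bar> \<le> C"
    by (auto simp: bounded_iff)
  then have inside: "\<bar>poly q \<xi>\<bar> \<le> C" if "\<bar>\<xi>\<bar> \<le> b" for \<xi>
    using that by (auto simp: abs_le_iff minus_le_iff)
  have "(cmod (poly_times q g \<xi>))\<^sup>2 \<le> C\<^sup>2 * (cmod (g \<xi>))\<^sup>2 + inverse (1 + \<xi>\<^sup>2)" for \<xi>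
  proof (cases "\<bar>\<xi>\<bar> \<le> b")
    case True
    then have "(cmod (poly_times q g \<xi>))\<^sup>2 \<le> C\<^sup>2 * (cmod (g \<xi>))\<^sup>2"
      using inside unfolding poly_times_def norm_mult norm_of_real power_mult_distrib
      by (intro mult_right_mono power_mono) auto
    then show ?thesis by (simp add: add_increasing2)
  next
    case False
    have weight: "1 + \<xi>\<^sup>2 > 0" by (simp add: add_pos_nonneg)
    have "poly_times ([:1, 0, 1:] * q) g \<xi> = complex_of_real (1 + \<xi>\<^sup>2) * poly_times q g \<xi>"
      by (simp add: poly_times_def power2_eq_square algebra_simps)
    then have "cmod (poly_times ([:1, 0, 1:] * q) g \<xi>) = (1 + \<xi>\<^sup>2) * cmod (poly_times q g \<xi>)"
      using weight by (simp only: norm_mult norm_of_real abs_of_pos)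
    then have "(1 + \<xi>\<^sup>2) * cmod (poly_times q g \<xi>) \<le> 1"
      using outside[of \<xi>] False by simp
    then have "cmod (poly_times q g \<xi>) \<le> inverse (1 + \<xi>\<^sup>2)"
      using weight by (simp add: field_simps)
    moreover have "inverse (1 + \<xi>\<^sup>2) \<le> 1"
      by (simp add: inverse_le_1_iff)
    ultimately have "(cmod (poly_times q g \<xi>))\<^sup>2 \<le> inverse (1 + \<xi>\<^sup>2) * 1"
      unfolding power2_eq_square by (intro mult_mono) auto
    then show ?thesis by (simp add: add_increasing)
  qed
  then show ?thesis
    by (rule that)
qed

lemma poly_times_L2_space:
  assumes g: "g \<in> L2_space" and decay: "rapidly_decreasing g"
  shows "poly_times q g \<in> L2_space"
proof -
  have [measurable]: "g \<in> borel_measurable lebesgue"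
    and g2: "integrable lebesgue (\<lambda>x. (cmod (g x))\<^sup>2)"
    using g by (auto simp: L2_space_def)
  obtain C where bound: "(cmod (poly_times q g \<xi>))\<^sup>2 \<le> C\<^sup>2 * (cmod (g \<xi>))\<^sup>2 + inverse (1 + \<xi>\<^sup>2)" for \<xi>
    using rapidly_decreasing_poly_times_bound[OF decay] by blast
  have "integrable lebesgue (\<lambda>\<xi>. (cmod (poly_times q g \<xi>))\<^sup>2)"
  proof (rule Bochner_Integration.integrable_bound)
    show "integrable lebesgue (\<lambda>\<xi>. C\<^sup>2 * (cmod (g \<xi>))\<^sup>2 + inverse (1 + \<xi>\<^sup>2))"
      using g2 integrable_lebesgue_inverse_1_plus_square by simp
    show "AE \<xi> in lebesgue. norm ((cmod (poly_times q g \<xi>))\<^sup>2)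
        \<le> norm (C\<^sup>2 * (cmod (g \<xi>))\<^sup>2 + inverse (1 + \<xi>\<^sup>2))"
      using bound by (simp add: order_trans[OF _ abs_ge_self])
  qed measurable
  then show ?thesis
    by (simp add: L2_space_def)
qed

lemma integrable_of_weighted_L2:
  assumes h: "h \<in> L2_space" and xh: "(\<lambda>x. complex_of_real x * h x) \<in> L2_space"
  shows "integrable lebesgue h"
proof (rule Bochner_Integration.integrable_bound)
  show "h \<in> borel_measurable lebesgue"
    using h by (simp add: L2_space_def)
  show "integrable lebesgue (\<lambda>x.
      inverse (1 + x\<^sup>2) + ((cmod (h x))\<^sup>2 + (cmod (complex_of_real x * h x))\<^sup>2))"
    using h xh integrable_lebesgue_inverse_1_plus_square by (simp add: L2_space_def)
  have "cmod (h x) \<le> inverse (1 + x\<^sup>2) + ((cmod (h x))\<^sup>2 + (cmod (complex_of_real x * h x))\<^sup>2)" for x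
  proof -
    define w where "w = sqrt (1 + x\<^sup>2)"
    have w: "w > 0" "w\<^sup>2 = 1 + x\<^sup>2"
      by (simp_all add: w_def add_pos_nonneg)
    have "cmod (h x) \<le> 2 * inverse w * (w * cmod (h x))"
      using w(1) by (simp add: field_simps)
    also have "\<dots> \<le> (inverse w)\<^sup>2 + (w * cmod (h x))\<^sup>2"
      by (rule sum_squares_bound)
    also have "\<dots> = inverse (1 + x\<^sup>2) + ((cmod (h x))\<^sup>2 + (cmod (complex_of_real x * h x))\<^sup>2)"
      by (simp add: w(2) norm_mult power_mult_distrib power_inverse distrib_right)
    finally show ?thesis .
  qed
  then show "AE x in lebesgue. norm (h x)
      \<le> norm (inverse (1 + x\<^sup>2) + ((cmod (h x))\<^sup>2 + (cmod (complex_of_real x * h x))\<^sup>2))"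
    by (simp add: order_trans[OF _ abs_ge_self])
qed

lemma integrable_poly_times:
  assumes "g \<in> L2_space" "rapidly_decreasing g"
  shows "integrable lebesgue (poly_times q g)"
proof (rule integrable_of_weighted_L2)
  have "(\<lambda>x. complex_of_real x * poly_times q g x) = poly_times ([:0, 1:] * q) g"
    by (simp add: poly_times_def fun_eq_iff)
  then show "(\<lambda>x. complex_of_real x * poly_times q g x) \<in> L2_space"
    using poly_times_L2_space[OF assms] by simp
qed (rule poly_times_L2_space[OF assms])

section \<open>The weight \<open>|g|\<^sup>2\<close>\<close>

definition weight_measure :: "(real \<Rightarrow> complex) \<Rightarrow> real measure" where
  "weight_measure g = density lebesgue (\<lambda>\<xi>. ennreal ((cmod (g \<xi>))\<^sup>2))"

lemma weight_mult_poly_eq: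
  "complex_of_real ((cmod (g x))\<^sup>2 * poly (q * r) x) = cnj (poly_times q g x) * poly_times r g x"
  by (simp add: poly_times_def complex_norm_square mult_ac del: of_real_power)

lemma L2_inner_poly_times:
  assumes [measurable]: "g \<in> borel_measurable lebesgue"
  shows "L2_inner (poly_times q g) (poly_times r g)
    = complex_of_real (LINT x|weight_measure g. poly q x * poly r x)"
proof -
  have "(LINT x|weight_measure g. poly q x * poly r x)
      = (LINT x|lebesgue. (cmod (g x))\<^sup>2 * poly (q * r) x)"
    unfolding weight_measure_def by (subst integral_density) auto
  then show ?thesis
    unfolding L2_inner_def weight_mult_poly_eq[symmetric] by (simp only: integral_complex_of_real)
qed

lemma integrable_weight_measure_poly:
  assumes g: "g \<in> L2_space" and decay: "rapidly_decreasing g"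
  shows "integrable (weight_measure g) (poly q)"
proof -
  have [measurable]: "g \<in> borel_measurable lebesgue"
    using g by (simp add: L2_space_def)
  have square_integrable: "integrable lebesgue (\<lambda>x. (cmod (poly_times r g x))\<^sup>2)" for r
    using poly_times_L2_space[OF g decay] by (simp add: L2_space_def)
  have "integrable lebesgue (\<lambda>x. cnj (poly_times 1 g x) * poly_times q g x)"
    by (intro integrable_cnj_mult square_integrable) measurable
  then have "integrable lebesgue (\<lambda>x. (cmod (g x))\<^sup>2 * poly q x)"
    unfolding weight_mult_poly_eq[symmetric] complex_of_real_integrable_eq by simp
  then show ?thesis
    unfolding weight_measure_def by (subst integrable_density) auto
qed

lemma measure_weight_measure:
  assumes [measurable]: "g \<in> borel_measurable lebesgue"
  shows "measure (weight_measure g) (space (weight_measure g)) = (L2_nrm g)\<^sup>2"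
proof -
  have "measure (weight_measure g) (space (weight_measure g)) = (LINT x|weight_measure g. 1)"
    by simp
  also have "\<dots> = (LINT x|lebesgue. (cmod (g x))\<^sup>2)"
    unfolding weight_measure_def by (subst integral_density) auto
  finally show ?thesis
    by (simp add: L2_nrm_def)
qed

section \<open>Orthogonal polynomials for two measures\<close>

lemma poly_graded_expansion:
  fixes p :: "nat \<Rightarrow> 'a::field poly"
  assumes degree: "\<And>n. degree (p n) = n" and "p 0 \<noteq> 0"
  obtains c where "q = (\<Sum>i\<le>degree q. smult (c i) (p i))"
proof -
  have "\<exists>c. q = (\<Sum>i<d. smult (c i) (p i))" if "q = 0 \<or> degree q < d" for d q
    using that
  proof (induction d arbitrary: q)
    case (Suc d)
    have "p d \<noteq> 0"
      using degree[of d] \<open>p 0 \<noteq> 0\<close> by (cases d) auto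
    define a where "a = coeff q d / lead_coeff (p d)"
    define r where "r = q - smult a (p d)"
    have "degree r \<le> d"
      unfolding r_def using Suc.prems
      by (intro degree_diff_le) (auto simp: degree intro: order_trans[OF degree_smult_le])
    moreover have "coeff r d = 0"
      using \<open>p d \<noteq> 0\<close> leading_coeff_neq_0[of "p d"] by (simp add: r_def a_def degree)
    ultimately have "r = 0 \<or> degree r < d"
      by (rule eq_zero_or_degree_less)
    then obtain c where "r = (\<Sum>i<d. smult (c i) (p i))"
      using Suc.IH by blast
    then have "q = (\<Sum>i<Suc d. smult ((c(d := a)) i) (p i))"
      by (simp add: r_def algebra_simps)
    then show ?case by blast
  qed simp
  from this[of q "Suc (degree q)"] show ?thesis
    using that by (auto simp: lessThan_Suc_atMost)
qed

lemma integral_orthogonal_polys: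
  assumes orth: "orthogonal_polys M p" and p0: "p 0 = [:b:]" "b \<noteq> 0" and "n \<noteq> 0"
  shows "(LINT x|M. poly (p n) x) = 0"
proof -
  have "b * (LINT x|M. poly (p n) x) = (LINT x|M. poly (p 0) x * poly (p n) x)"
    by (simp add: p0)
  also have "\<dots> = 0"
    using orth \<open>n \<noteq> 0\<close> by (simp add: orthogonal_polys_def)
  finally show ?thesis using p0 by simp
qed

lemma integral_orthogonal_polys_expansion:
  assumes orth: "orthogonal_polys M p" and integrable: "\<And>q. integrable M (poly q)"
    and p0: "p 0 = [:b:]" "b \<noteq> 0"
  shows "(LINT x|M. poly (\<Sum>i\<le>n. smult (c i) (p i)) x) = c 0 * b * measure M (space M)"
proof -
  have "(LINT x|M. poly (\<Sum>i\<le>n. smult (c i) (p i)) x) = (\<Sum>i\<le>n. c i * (LINT x|M. poly (p i) x))"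
    by (simp add: poly_sum integrable)
  also have "\<dots> = (\<Sum>i\<in>{0}. c i * (LINT x|M. poly (p i) x))"
    by (rule sum.mono_neutral_right) (auto simp: integral_orthogonal_polys[OF orth p0])
  finally show ?thesis by (simp add: p0)
qed

lemma orthogonal_polys_integral_proportional:
  assumes degree: "\<And>n. degree (p n) = n" and "p 0 \<noteq> 0"
    and M: "orthogonal_polys M p" "\<And>q. integrable M (poly q)"
    and N: "orthogonal_polys N p" "\<And>q. integrable N (poly q)"
  shows "measure M (space M) * (LINT x|N. poly q x) = measure N (space N) * (LINT x|M. poly q x)"
proof -
  obtain b where p0: "p 0 = [:b:]" "b \<noteq> 0"
    using degree[of 0] \<open>p 0 \<noteq> 0\<close> by (auto elim: degree_eq_zeroE)
  obtain c where expansion: "q = (\<Sum>i\<le>degree q. smult (c i) (p i))"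
    using poly_graded_expansion[of p q] degree \<open>p 0 \<noteq> 0\<close> by blast
  have "(LINT x|M. poly q x) = c 0 * b * measure M (space M)"
    by (subst expansion) (rule integral_orthogonal_polys_expansion[OF M p0])
  moreover have "(LINT x|N. poly q x) = c 0 * b * measure N (space N)"
    by (subst expansion) (rule integral_orthogonal_polys_expansion[OF N p0])
  ultimately show ?thesis by simp
qed

lemma integral_orthogonal_eq_scaled_orthonormal:
  assumes "prob_space \<mu>" and moments: "\<And>n::nat. integrable \<mu> (\<lambda>x. x ^ n)"
    and degree: "\<And>n. degree (p n) = n" and orthonormal: "orthonormal_polys \<mu> p"
    and N: "orthogonal_polys N p" "\<And>q. integrable N (poly q)"
  shows "(LINT x|N. poly (p m) x * poly (p n) x) = (if m = n then measure N (space N) else 0)"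
proof -
  interpret prob_space \<mu> by fact
  have integral_\<mu>: "(LINT x|\<mu>. poly (p m * p n) x) = (if m = n then 1 else 0)" for m n
    using orthonormal by (simp add: orthonormal_polys_def)
  have "orthogonal_polys \<mu> p"
    using integral_\<mu> by (simp add: orthogonal_polys_def)
  moreover have "p 0 \<noteq> 0"
    using integral_\<mu>[of 0 0] by auto
  moreover have "integrable \<mu> (poly q)" for q
    unfolding poly_altdef using moments by simp
  ultimately have "measure \<mu> (space \<mu>) * (LINT x|N. poly (p m * p n) x)
      = measure N (space N) * (LINT x|\<mu>. poly (p m * p n) x)"
    using N degree by (intro orthogonal_polys_integral_proportional)
  then show ?thesis
    using integral_\<mu> by (simp add: prob_space)
qed

section \<open>The Fourier family\<close>

lemma fourier_family_eq:
  "fourier_family p g \<theta> n x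
    = cis (\<theta> n) / complex_of_real (sqrt (2 * pi)) * fourier (poly_times (p n) g) x"
  by (simp add: fourier_family_def fourier_def poly_times_def cis_conv_exp mult.assoc)

lemma fourier_family_L2_space:
  assumes "g \<in> L2_space" "rapidly_decreasing g"
  shows "fourier_family p g \<theta> n \<in> L2_space"
  unfolding fourier_family_eq[abs_def]
  by (intro L2_space_cmult fourier_L2_space poly_times_L2_space integrable_poly_times assms)

lemma L2_inner_fourier_family:
  assumes g: "g \<in> L2_space" "rapidly_decreasing g"
  shows "L2_inner (fourier_family p g \<theta> m) (fourier_family p g \<theta> n)
    = cis (\<theta> n - \<theta> m) * complex_of_real (LINT x|weight_measure g. poly (p m) x * poly (p n) x)"
proof -
  let ?c = "\<lambda>n. cis (\<theta> n) / complex_of_real (sqrt (2 * pi))"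
  have "L2_inner (fourier_family p g \<theta> m) (fourier_family p g \<theta> n)
      = cnj (?c m) * ?c n * L2_inner (fourier (poly_times (p m) g)) (fourier (poly_times (p n) g))"
    unfolding fourier_family_eq[abs_def] by (rule L2_inner_cmult)
  also have "\<dots> = cnj (?c m) * ?c n * (2 * pi * L2_inner (poly_times (p m) g) (poly_times (p n) g))"
    by (simp only: parseval poly_times_L2_space integrable_poly_times g)
  also have "cnj (?c m) * ?c n = cis (\<theta> n - \<theta> m) / (2 * pi)"
    by (simp add: cis_cnj cis_mult of_real_sqrt_mult_self del: real_sqrt_mult)
  also have "L2_inner (poly_times (p m) g) (poly_times (p n) g)
      = complex_of_real (LINT x|weight_measure g. poly (p m) x * poly (p n) x)"
    using g(1) by (intro L2_inner_poly_times) (simp add: L2_space_def)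
  finally show ?thesis by simp
qed

lemma orthogonal_fourier_family_iff:
  assumes "g \<in> L2_space" "rapidly_decreasing g"
  shows "orthogonal_family (fourier_family p g \<theta>) \<longleftrightarrow> orthogonal_polys (weight_measure g) p"
  by (simp add: orthogonal_family_def orthogonal_polys_def L2_inner_fourier_family[OF assms])

lemma orthonormal_fourier_family:
  assumes g: "g \<in> L2_space" "rapidly_decreasing g" and "L2_nrm g \<noteq> 0"
    and \<mu>: "prob_space \<mu>" "\<And>n::nat. integrable \<mu> (\<lambda>x. x ^ n)"
    and p: "\<And>n. degree (p n) = n" "orthonormal_polys \<mu> p" "orthogonal_polys (weight_measure g) p"
  shows "orthonormal_family (\<lambda>n x. fourier_family p g \<theta> n x / complex_of_real (L2_nrm g))"
proof (rule orthonormal_family_normalized)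
  have "(LINT x|weight_measure g. poly (p m) x * poly (p n) x)
      = (if m = n then (L2_nrm g)\<^sup>2 else 0)" for m n
    using integral_orthogonal_eq_scaled_orthonormal[OF \<mu> p integrable_weight_measure_poly[OF g]] g(1)
    by (simp add: measure_weight_measure L2_space_def)
  then show "L2_inner (fourier_family p g \<theta> m) (fourier_family p g \<theta> n)
      = (if m = n then complex_of_real ((L2_nrm g)\<^sup>2) else 0)" for m n
    by (simp add: L2_inner_fourier_family[OF g])
qed fact

theorem theorem2:
  fixes \<mu> :: "real measure"
    and p :: "nat \<Rightarrow> real poly"
    and g :: "real \<Rightarrow> complex"
    and \<theta> :: "nat \<Rightarrow> real"
  assumes "real_distribution \<mu>"
    and "\<And>n::nat. integrable \<mu> (\<lambda>x. x ^ n)"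
    and "infinite (measure_support \<mu>)"
    and "\<And>n. degree (p n) = n"
    and "orthonormal_polys \<mu> p"
    and "g \<in> L2_space"
    and "\<not> (AE \<xi> in lebesgue. g \<xi> = 0)"
    and "\<And>n::nat. ((\<lambda>\<xi>. cmod (complex_of_real (\<xi> ^ n) * g \<xi>)) \<longlongrightarrow> 0) at_infinity"
    and "\<And>n. \<theta> n \<in> {0..<2 * pi}"
  shows "(\<forall>n. fourier_family p g \<theta> n \<in> L2_space) \<and>
    (orthogonal_family (fourier_family p g \<theta>) \<longleftrightarrow>
       orthogonal_polys (density lebesgue (\<lambda>\<xi>. ennreal ((cmod (g \<xi>))\<^sup>2))) p) \<and>
    (orthogonal_family (fourier_family p g \<theta>) \<longrightarrow>
       orthonormal_family (\<lambda>n x. fourier_family p g \<theta> n x / complex_of_real (L2_nrm g)))"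
proof -
  have g: "g \<in> L2_space" "rapidly_decreasing g"
    using assms(6,8) by (simp_all add: rapidly_decreasing_def)
  have "L2_nrm g \<noteq> 0"
    using assms(6,7) by (simp add: L2_nrm_eq_0_iff)
  moreover have "prob_space \<mu>"
    using assms(1) by (simp add: real_distribution_def)
  ultimately have "orthonormal_family (\<lambda>n x. fourier_family p g \<theta> n x / complex_of_real (L2_nrm g))"
    if "orthogonal_polys (weight_measure g) p"
    using orthonormal_fourier_family[OF g _ _ assms(2,4,5) that] by blast
  then show ?thesis
    using fourier_family_L2_space[OF g] orthogonal_fourier_family_iff[OF g]
    by (simp add: weight_measure_def)
qed

end
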